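(* Let $n\ge2$ and let $0\le\alpha_1<\dots<\alpha_n$ be integers. If a correct score sequence for $D=\{\alpha_1,\dots,\alpha_n\}$ exists, i.e. positive integers $x_1,\dots,x_n$ such that the non-decreasing sequence consisting of $\alpha_i$ repeated $x_i$ times ($i=1,\dots,n$) is the score sequence of some tournament, then the fast reconstruction algorithm described in the context, run on $D$, reconstructs a correct score sequence (its main call returns TRUE with $(x_1,\dots,x_n)$ a correct score sequence).
   Context: A tournament is an orientation of a complete graph; its score sequence is its sequence of out-degrees. Fast reconstruction algorithm: let $m=\alpha_n-\alpha_{n-1}$, $a\bmod m$ the least nonnegative residue; $sol=(s_0,\dots,s_{m-1})$ with $s_i=((2\alpha_n+1-2i)i)\bmod m$; $g_i=(\alpha_n-\alpha_i)\bmod m$ ($1\le i\le n-1$); $\mu_i=\gcd(g_i,\dots,g_{n-1},m)$ ($1\le i\le n-1$). Let $\mathrm{cb}(P,Q,a)=\frac{2(a-P)+1+\sqrt{(2(a-P)+1)^2+8(Q-P(P-1)/2)}}{2}$. $\mathrm{potential}(S,\mu)$ is TRUE iff some entry $s$ of $S$ satisfies ($s=0$ and $\mu=0$) or $s\bmod\mu=0$. $\mathrm{end}(i,P,Q)$: let $b_1=(2\alpha_n+1)/2$, $b_2=\mathrm{cb}(P,Q,\alpha_{n-1})$; for $i,\,i+m,\,i+2m,\dots$ as long as the current value $i\le b_1$: let $t_1=\frac{(2\alpha_n+1-2i)i-P\alpha_n+Q}{m}$; if $t_1$ is an integer with $1\le t_1\le b_2$, let $t_2=\mathrm{cb}(P+t_1,Q+t_1\alpha_{n-1},\alpha_n)$,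 and if $t_2$ is an integer with $t_2\ge1$, set $x_n=t_2$, $x_{n-1}=t_1$ and return TRUE; after the loop return FALSE. $\mathrm{rec}(S,\ell,P,Q)$: if $\ell\ge n-1$, then for $i=0,\dots,m-1$, if the $i$-th entry of $S$ is $0$ and $\mathrm{end}(i,P,Q)$ is TRUE, return TRUE; then return FALSE. Otherwise let $b=\mathrm{cb}(P,Q,\alpha_\ell)$; for each integer $i$ from $1$ to $b$: let $sum=\sum_{j=1}^{\ell-1}g_jx_j+g_\ell\, i$ and let $S'$ have $j$-th entry $(S_j-sum)\bmod m$; if $\mathrm{potential}(S',\mu_{\ell+1})$, set $x_\ell=i$ and if $\mathrm{rec}(S',\ell+1,P+i,Q+i\alpha_\ell)$ is TRUE return TRUE; after the loop return FALSE. The main call is $\mathrm{rec}(sol,1,0,0)$.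
   Formalization: In rec, the j-th entry of S' is taken as (s_j − sum) mod m with s_j from the initial vector sol, not from the argument S; with S_j from S the earlier contributions are subtracted repeatedly and the algorithm wrongly returns FALSE on D={0,1,3,5}. *)

theory Defs
  imports Complex_Main "HOL-Library.Multiset"
begin

definition tournament :: "'v set \<Rightarrow> ('v \<times> 'v) set \<Rightarrow> bool" where
  "tournament V T \<longleftrightarrow>
     finite V \<and> T \<subseteq> V \<times> V \<and> (\<forall>v\<in>V. (v, v) \<notin> T) \<and>
     (\<forall>u\<in>V. \<forall>v\<in>V. u \<noteq> v \<longrightarrow> ((u, v) \<in> T \<longleftrightarrow> (v, u) \<notin> T))"

definition out_deg :: "('v \<times> 'v) set \<Rightarrow> 'v \<Rightarrow> nat" where
  "out_deg T v = card {w. (v, w) \<in> T}"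

definition score_sequence :: "'v set \<Rightarrow> ('v \<times> 'v) set \<Rightarrow> nat list" where
  "score_sequence V T = sorted_list_of_multiset (image_mset (out_deg T) (mset_set V))"

definition correct_score_sequence :: "nat \<Rightarrow> (nat \<Rightarrow> int) \<Rightarrow> (nat \<Rightarrow> int) \<Rightarrow> bool" where
  "correct_score_sequence n \<alpha> x \<longleftrightarrow>
     (\<forall>i\<in>{1..n}. x i \<ge> 1) \<and>
     (\<exists>(V :: nat set) T. tournament V T \<and>
        map int (score_sequence V T) = concat (map (\<lambda>i. replicate (nat (x i)) (\<alpha> i)) [1..<Suc n]))"

text \<open>
  The algorithm is imperative. Each procedure takes the current contents of the variables
  \<open>x\<^sub>1, \<dots>, x\<^sub>n\<close> as its last argument and returns its truth value together with their
  contents on exit.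
\<close>

definition fr_m :: "nat \<Rightarrow> (nat \<Rightarrow> int) \<Rightarrow> int" where
  "fr_m n \<alpha> = \<alpha> n - \<alpha> (n - 1)"

definition fr_sol :: "nat \<Rightarrow> (nat \<Rightarrow> int) \<Rightarrow> int list" where
  "fr_sol n \<alpha> = map (\<lambda>i. ((2 * \<alpha> n + 1 - 2 * i) * i) mod fr_m n \<alpha>) [0..fr_m n \<alpha> - 1]"

definition fr_g :: "nat \<Rightarrow> (nat \<Rightarrow> int) \<Rightarrow> nat \<Rightarrow> int" where
  "fr_g n \<alpha> i = (\<alpha> n - \<alpha> i) mod fr_m n \<alpha>"

definition fr_mu :: "nat \<Rightarrow> (nat \<Rightarrow> int) \<Rightarrow> nat \<Rightarrow> int" where
  "fr_mu n \<alpha> i = Gcd (insert (fr_m n \<alpha>) (fr_g n \<alpha> ` {i..n - 1}))"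

definition cb :: "real \<Rightarrow> real \<Rightarrow> real \<Rightarrow> real" where
  "cb P Q a = (2 * (a - P) + 1 + sqrt ((2 * (a - P) + 1)\<^sup>2 + 8 * (Q - P * (P - 1) / 2))) / 2"

definition potential :: "int list \<Rightarrow> int \<Rightarrow> bool" where
  "potential S \<mu> \<longleftrightarrow> (\<exists>s\<in>set S. (s = 0 \<and> \<mu> = 0) \<or> s mod \<mu> = 0)"

text \<open>A for-loop that is left as soon as its body returns \<open>True\<close>.\<close>

fun for_loop :: "'i list \<Rightarrow> ('i \<Rightarrow> 's \<Rightarrow> bool \<times> 's) \<Rightarrow> 's \<Rightarrow> bool \<times> 's" where
  "for_loop [] body x = (False, x)"
| "for_loop (i # is) body x =
     (let (found, x') = body i x in if found then (True, x') else for_loop is body x')"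

text \<open>
  The guard \<open>0 < fr_m n \<alpha>\<close> only makes the function total; it holds whenever \<open>\<alpha>\<close> is strictly
  increasing.
\<close>

function fr_end :: "nat \<Rightarrow> (nat \<Rightarrow> int) \<Rightarrow> int \<Rightarrow> int \<Rightarrow> int \<Rightarrow> (nat \<Rightarrow> int) \<Rightarrow> bool \<times> (nat \<Rightarrow> int)" where
  "fr_end n \<alpha> i P Q x =
     (if 0 < fr_m n \<alpha> \<and> real_of_int i \<le> (2 * real_of_int (\<alpha> n) + 1) / 2 then
        let t1 = real_of_int ((2 * \<alpha> n + 1 - 2 * i) * i - P * \<alpha> n + Q) / real_of_int (fr_m n \<alpha>);
            t2 = cb (P + t1) (Q + t1 * \<alpha> (n - 1)) (\<alpha> n)
        in if t1 \<in> \<int> \<and> 1 \<le> t1 \<and> t1 \<le> cb P Q (\<alpha> (n - 1)) \<and> t2 \<in> \<int> \<and> 1 \<le> t2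
           then (True, x(n := \<lfloor>t2\<rfloor>, n - 1 := \<lfloor>t1\<rfloor>))
           else fr_end n \<alpha> (i + fr_m n \<alpha>) P Q x
      else (False, x))"
  by pat_completeness auto
termination
  by (relation "measure (\<lambda>(n, \<alpha>, i, P, Q, x). nat (\<alpha> n + 1 - i))") auto

text \<open>
  The number \<open>sum\<close> accumulates the contributions of all of \<open>x\<^sub>1, \<dots>, x\<^sub>l\<close>, so the new residues
  are obtained by subtracting it from the entries of the initial vector \<open>sol\<close>. Subtracting it
  from the entries of the argument \<open>S\<close>, which already account for \<open>x\<^sub>1, \<dots>, x\<^bsub>l-1\<^esub>\<close>, would
  count these contributions repeatedly, and the algorithm would then fail, for example, on
  \<open>{0, 1, 2, 5}\<close>.
\<close>

function fr_rec ::
  "nat \<Rightarrow> (nat \<Rightarrow> int) \<Rightarrow> int list \<Rightarrow> nat \<Rightarrow> int \<Rightarrow> int \<Rightarrow> (nat \<Rightarrow> int) \<Rightarrow> bool \<times> (nat \<Rightarrow> int)" where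
  "fr_rec n \<alpha> S l P Q x =
     (if n - 1 \<le> l then
        for_loop [0..fr_m n \<alpha> - 1]
          (\<lambda>i x. if S ! nat i = 0 then fr_end n \<alpha> i P Q x else (False, x)) x
      else
        for_loop [1..\<lfloor>cb P Q (\<alpha> l)\<rfloor>]
          (\<lambda>i x.
             let sum = (\<Sum>j = 1..l - 1. fr_g n \<alpha> j * x j) + fr_g n \<alpha> l * i;
                 S' = map (\<lambda>s. (s - sum) mod fr_m n \<alpha>) (fr_sol n \<alpha>)
             in if potential S' (fr_mu n \<alpha> (l + 1))
                then fr_rec n \<alpha> S' (l + 1) (P + i) (Q + i * \<alpha> l) (x(l := i))
                else (False, x)) x)"
  by pat_completeness auto
termination
  by (relation "measure (\<lambda>(n, \<alpha>, S, l, P, Q, x). n - l)") auto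

declare fr_end.simps [simp del] fr_rec.simps [simp del]

definition fast_reconstruction :: "nat \<Rightarrow> (nat \<Rightarrow> int) \<Rightarrow> (nat \<Rightarrow> int) \<Rightarrow> bool \<times> (nat \<Rightarrow> int)" where
  "fast_reconstruction n \<alpha> x = fr_rec n \<alpha> (fr_sol n \<alpha>) 1 0 0 x"

end

theory Submission
  imports Defs "HOL-Library.Transitive_Closure_Table"
begin

text \<open>
  By Landau's theorem, \<open>x\<close> is a correct score sequence iff, with \<open>P\<close> the number and \<open>Q\<close> the sum of
  the scores in the first \<open>l\<close> blocks, the excess \<open>2 Q - P (P - 1)\<close> is nonnegative for every \<open>l\<close>
  and zero for \<open>l = n\<close>. If it is nonnegative after \<open>l - 1\<close> blocks, then it stays so iff
  \<open>x\<^sub>l \<le> cb P Q \<alpha>\<^sub>l\<close>, and it vanishes in the case of equality. Hence every answer of the search is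
  correct. Conversely, the search cannot prune a correct \<open>x\<close>: if it has \<open>N\<close> vertices and \<open>2 j\<close> is
  the even one of \<open>N\<close> and \<open>2 \<alpha>\<^sub>n + 1 - N\<close>, vanishing of the last excess reads
  \<open>(2 \<alpha>\<^sub>n + 1 - 2 j) j = (\<Sum>i<n. (\<alpha>\<^sub>n - \<alpha>\<^sub>i) x\<^sub>i)\<close>, so the entry of the residue vector at \<open>j mod m\<close>
  survives every divisibility test.
\<close>

section \<open>Landau's theorem\<close>

definition landau_excess :: "'a::comm_ring_1 \<Rightarrow> 'a \<Rightarrow> 'a" where
  "landau_excess P Q = 2 * Q - P * (P - 1)"

lemma of_int_landau_excess:
  "of_int (landau_excess P Q) = landau_excess (of_int P) (of_int Q)"
  by (simp add: landau_excess_def)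

lemma landau_excess_add:
  "landau_excess (P + t) (Q + t * a) = landau_excess P Q + t * (2 * (a - P) + 1 - t)"
  by (simp add: landau_excess_def algebra_simps)

lemma tournament_finite: "tournament V T \<Longrightarrow> finite V"
  by (simp add: tournament_def)

lemma tournament_subset: "tournament V T \<Longrightarrow> T \<subseteq> V \<times> V"
  by (simp add: tournament_def)

lemma tournament_finite_arcs: "tournament V T \<Longrightarrow> finite T"
  by (rule finite_subset[OF tournament_subset finite_SigmaI]) (auto dest: tournament_finite)

lemma tournament_exists:
  assumes "finite V"
  shows "\<exists>T. tournament V T"
proof -
  obtain f :: "'a \<Rightarrow> nat" where "inj_on f V"
    using assms finite_imp_inj_to_nat_seg by blast
  then have "tournament V {(u, v). u \<in> V \<and> v \<in> V \<and> f u < f v}"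
    by (auto simp: tournament_def assms inj_on_eq_iff not_less less_le)
  then show ?thesis ..
qed

lemma tournament_card_arcs_within:
  assumes T: "tournament V T" and "U \<subseteq> V"
  shows "2 * card (T \<inter> U \<times> U) = card U * (card U - 1)"
proof -
  let ?A = "T \<inter> U \<times> U"
  have finite_U: "finite U" "finite ?A"
    using assms tournament_finite tournament_finite_arcs finite_subset by blast+
  have arc: "(u, u) \<notin> T" "u \<noteq> v \<Longrightarrow> (u, v) \<in> T \<longleftrightarrow> (v, u) \<notin> T" if "u \<in> U" "v \<in> U" for u v
    using that assms unfolding tournament_def by blast+
  have "?A \<union> ?A\<inverse> = U \<times> U - Id_on U" using arc by auto
  moreover have "?A \<inter> ?A\<inverse> = {}" using arc by auto
  ultimately have "card (U \<times> U - Id_on U) = card ?A + card (?A\<inverse>)"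
    using finite_U by (metis card_Un_disjoint finite_converse)
  moreover have "card (U \<times> U - Id_on U) = card U * card U - card U"
    using finite_U by (subst card_Diff_subset)
      (auto simp: Id_on_def card_cartesian_product card_image inj_on_def UNION_singleton_eq_range)
  ultimately show ?thesis by (simp add: diff_mult_distrib2)
qed

lemma finite_out_neighbours: "finite T \<Longrightarrow> finite {w. (v, w) \<in> T}"
  using finite_Image[of T "{v}"] by (simp add: Image_singleton)

lemma sum_out_deg:
  assumes "finite T" "finite U"
  shows "(\<Sum>u\<in>U. out_deg T u) = card (T \<inter> U \<times> UNIV)"
proof -
  have "(\<Sum>u\<in>U. out_deg T u) = card (SIGMA u:U. {w. (u, w) \<in> T})"
    using assms by (simp add: out_deg_def finite_out_neighbours)
  also have "(SIGMA u:U. {w. (u, w) \<in> T}) = T \<inter> U \<times> UNIV" by auto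
  finally show ?thesis .
qed

lemma tournament_landau_excess:
  assumes T: "tournament V T" and U: "U \<subseteq> V"
  shows "landau_excess (int (card U)) (\<Sum>u\<in>U. int (out_deg T u)) =
    2 * (int (card (T \<inter> U \<times> UNIV)) - int (card (T \<inter> U \<times> U)))"
proof -
  have "finite U" using U tournament_finite[OF T] finite_subset by blast
  then have "(\<Sum>u\<in>U. int (out_deg T u)) = int (card (T \<inter> U \<times> UNIV))"
    using sum_out_deg[OF tournament_finite_arcs[OF T]] by (metis of_nat_sum)
  moreover have "2 * int (card (T \<inter> U \<times> U)) = int (card U) * (int (card U) - 1)"
    using arg_cong[OF tournament_card_arcs_within[OF T U], of int]
    by (cases "card U") (simp_all add: algebra_simps)
  ultimately show ?thesis by (simp add: landau_excess_def)
qed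

lemma tournament_landau_excess_nonneg:
  assumes T: "tournament V T" and "U \<subseteq> V"
  shows "0 \<le> landau_excess (int (card U)) (\<Sum>u\<in>U. int (out_deg T u))"
proof -
  have "card (T \<inter> U \<times> U) \<le> card (T \<inter> U \<times> UNIV)"
    using tournament_finite_arcs[OF T] by (intro card_mono) auto
  then show ?thesis using tournament_landau_excess[OF assms] by simp
qed

lemma tournament_landau_excess_closed:
  assumes "tournament V T" "U \<subseteq> V" "T `` U \<subseteq> U"
  shows "landau_excess (int (card U)) (\<Sum>u\<in>U. int (out_deg T u)) = 0"
proof -
  have "T \<inter> U \<times> UNIV = T \<inter> U \<times> U" using assms(3) by blast
  then show ?thesis using tournament_landau_excess[OF assms(1,2)] by simp
qed

lemma tournament_landau_excess_total:
  assumes "tournament V T"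
  shows "landau_excess (int (card V)) (\<Sum>v\<in>V. int (out_deg T v)) = 0"
  using tournament_landau_excess_closed[OF assms order_refl] tournament_subset[OF assms] by blast

definition transfers_win :: "'v \<Rightarrow> 'v \<Rightarrow> ('v \<times> 'v) set \<Rightarrow> ('v \<times> 'v) set \<Rightarrow> bool" where
  "transfers_win u w T T' \<longleftrightarrow>
     (\<forall>v. int (out_deg T' v) = int (out_deg T v) - of_bool (v = u) + of_bool (v = w))"

lemma tournament_reverse_arc:
  assumes T: "tournament V T" and arc: "(u, v) \<in> T"
  defines "T' \<equiv> insert (v, u) (T - {(u, v)})"
  shows "tournament V T'"
    and "transfers_win u v T T'"
proof -
  have in_V: "u \<in> V" "v \<in> V" using arc tournament_subset[OF T] by auto
  have distinct_ends: "u \<noteq> v" using T arc in_V unfolding tournament_def by blast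
  have not_vu: "(v, u) \<notin> T" using T arc in_V distinct_ends unfolding tournament_def by blast
  show "tournament V T'" using T in_V distinct_ends arc unfolding tournament_def T'_def by blast
  have finite_out: "finite {y. (a, y) \<in> T}" for a
    using tournament_finite_arcs[OF T] by (rule finite_out_neighbours)
  have out_u: "{y. (u, y) \<in> T'} = {y. (u, y) \<in> T} - {v}"
    and out_v: "{y. (v, y) \<in> T'} = insert u {y. (v, y) \<in> T}"
    using distinct_ends by (auto simp: T'_def)
  have "Suc (out_deg T' u) = out_deg T u"
    unfolding out_deg_def out_u using finite_out arc by (intro card_Suc_Diff1) simp_all
  moreover have "out_deg T' v = Suc (out_deg T v)"
    using finite_out not_vu by (simp add: out_deg_def out_v)
  moreover have "out_deg T' w = out_deg T w" if "w \<noteq> u" "w \<noteq> v" for w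
    using that by (simp add: out_deg_def T'_def)
  ultimately show "transfers_win u v T T'"
    using distinct_ends unfolding transfers_win_def by (auto simp flip: of_nat_Suc)
qed

lemma tournament_reverse_path:
  assumes "tournament V T" "rtrancl_path (\<lambda>a b. (a, b) \<in> T) u p w" "distinct (u # p)"
  shows "\<exists>T'. tournament V T' \<and> transfers_win u w T T'"
  using assms
proof (induction p arbitrary: u T)
  case Nil
  then have "u = w" by (auto elim: rtrancl_path.cases)
  then show ?case using Nil by (auto simp: transfers_win_def)
next
  case (Cons v p)
  then have arc: "(u, v) \<in> T" and path: "rtrancl_path (\<lambda>a b. (a, b) \<in> T) v p w"
    by (auto elim: rtrancl_path.cases)
  define T1 where "T1 = insert (v, u) (T - {(u, v)})"
  note T1 = tournament_reverse_arc[OF Cons.prems(1) arc, folded T1_def]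
  have "u \<notin> set (v # p)" using Cons.prems(3) by simp
  with path have "rtrancl_path (\<lambda>a b. (a, b) \<in> T1) v p w"
    by (induction rule: rtrancl_path.induct) (auto intro: rtrancl_path.intros simp: T1_def)
  then obtain T' where "tournament V T'" "transfers_win v w T1 T'"
    using Cons.IH[OF T1(1)] Cons.prems(3) by auto
  then show ?case using T1(2) by (intro exI[of _ T']) (simp add: transfers_win_def)
qed

lemma tournament_transfer_win:
  assumes "tournament V T" "(u, w) \<in> T\<^sup>*"
  shows "\<exists>T'. tournament V T' \<and> transfers_win u w T T'"
proof -
  obtain p where "rtrancl_path (\<lambda>a b. (a, b) \<in> T) u p w"
    using assms(2) by (auto simp: rtrancl_def rtranclp_eq_rtrancl_path)
  then obtain p' where "rtrancl_path (\<lambda>a b. (a, b) \<in> T) u p' w" "distinct (u # p')"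
    by (rule rtrancl_path_distinct)
  then show ?thesis by (rule tournament_reverse_path[OF assms(1)])
qed

lemma tournament_deficit_reachable:
  fixes s :: "'v \<Rightarrow> int"
  assumes T: "tournament V T" and surplus_u: "u \<in> V" "s u < int (out_deg T u)"
    and landau: "\<And>U. U \<subseteq> V \<Longrightarrow> 0 \<le> landau_excess (int (card U)) (sum s U)"
  shows "\<exists>w. (u, w) \<in> T\<^sup>* \<and> int (out_deg T w) < s w"
proof -
  define R where "R = T\<^sup>* `` {u}"
  have "R \<subseteq> insert u V"
    using tournament_subset[OF T] unfolding R_def by (blast elim: rtranclE)
  then have R_subset: "R \<subseteq> V" using surplus_u by blast
  have "T `` R \<subseteq> R" unfolding R_def by (auto intro: rtrancl_into_rtrancl)
  then have "(\<Sum>v\<in>R. int (out_deg T v)) \<le> sum s R"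
    using tournament_landau_excess_closed[OF T R_subset] landau[OF R_subset]
    by (simp add: landau_excess_def)
  moreover have "finite R" "u \<in> R"
    using R_subset tournament_finite[OF T] finite_subset by (auto simp: R_def)
  ultimately have "\<exists>w\<in>R. int (out_deg T w) < s w"
    using sum_strict_mono_ex1[of R s "\<lambda>v. int (out_deg T v)"] surplus_u(2) by force
  then show ?thesis by (auto simp: R_def)
qed

definition score_error :: "'v set \<Rightarrow> ('v \<Rightarrow> int) \<Rightarrow> ('v \<times> 'v) set \<Rightarrow> nat" where
  "score_error V s T = (\<Sum>v\<in>V. nat \<bar>int (out_deg T v) - s v\<bar>)"

lemma score_error_less:
  assumes "finite V" "u \<in> V" "s u < int (out_deg T u)" "int (out_deg T w) < s w"
    and "transfers_win u w T T'"
  shows "score_error V s T' < score_error V s T"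
  unfolding score_error_def
proof (rule sum_strict_mono_ex1[OF assms(1)])
  show "\<forall>v\<in>V. nat \<bar>int (out_deg T' v) - s v\<bar> \<le> nat \<bar>int (out_deg T v) - s v\<bar>"
    using assms(3-5) by (auto simp: transfers_win_def)
  show "\<exists>v\<in>V. nat \<bar>int (out_deg T' v) - s v\<bar> < nat \<bar>int (out_deg T v) - s v\<bar>"
    using assms(2-5) by (intro bexI[of _ u]) (auto simp: transfers_win_def)
qed

text \<open>
  Choose a tournament of minimal score error. A vertex of too large a score would reach one of too
  small a score, and reversing a path between them would lower the error.
\<close>

theorem landau_tournament_exists:
  fixes s :: "'v \<Rightarrow> int"
  assumes finite_V: "finite V"
    and landau: "\<And>U. U \<subseteq> V \<Longrightarrow> 0 \<le> landau_excess (int (card U)) (sum s U)"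
    and total: "landau_excess (int (card V)) (sum s V) = 0"
  shows "\<exists>T. tournament V T \<and> (\<forall>v\<in>V. int (out_deg T v) = s v)"
proof -
  obtain T where T: "tournament V T"
    and least: "\<And>T'. tournament V T' \<Longrightarrow> score_error V s T \<le> score_error V s T'"
    using ex_has_least_nat[of "tournament V" _ "score_error V s"] tournament_exists[OF finite_V]
    by blast
  have no_surplus: "\<forall>u\<in>V. int (out_deg T u) \<le> s u"
  proof (rule ccontr)
    assume "\<not> (\<forall>u\<in>V. int (out_deg T u) \<le> s u)"
    then obtain u where surplus_u: "u \<in> V" "s u < int (out_deg T u)" by force
    then obtain w where deficit_w: "(u, w) \<in> T\<^sup>*" "int (out_deg T w) < s w"
      using tournament_deficit_reachable[OF T] landau by blast
    then obtain T' where "tournament V T'" "transfers_win u w T T'"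
      using tournament_transfer_win[OF T] by blast
    then show False
      using least score_error_less[OF finite_V surplus_u deficit_w(2)] by (meson not_le)
  qed
  moreover have "(\<Sum>v\<in>V. int (out_deg T v)) = sum s V"
    using tournament_landau_excess_total[OF T] total by (simp add: landau_excess_def)
  ultimately have "\<forall>v\<in>V. int (out_deg T v) = s v"
    using sum_strict_mono_ex1[OF finite_V, of "\<lambda>v. int (out_deg T v)" s] by force
  then show ?thesis using T by blast
qed

lemma score_sequence_eqI:
  assumes "distinct vs" "sorted (map (out_deg T) vs)"
  shows "score_sequence (set vs) T = map (out_deg T) vs"
proof -
  have "image_mset (out_deg T) (mset_set (set vs)) = mset (map (out_deg T) vs)"
    using assms(1) by (simp add: mset_set_set)
  then show ?thesis
    using assms(2) by (simp only: score_sequence_def sorted_list_of_multiset_mset sorted_sort_id)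
qed

lemma sum_lessThan_card_le:
  fixes f :: "nat \<Rightarrow> 'a::ordered_comm_monoid_add"
  assumes "finite U" "mono_on {..<n} f" "U \<subseteq> {..<n}"
  shows "sum f {..<card U} \<le> sum f U"
  using assms
proof (induction U rule: finite_linorder_max_induct)
  case (insert b U)
  have "card U \<le> card {..<b}" using insert.hyps by (intro card_mono) auto
  then have "f (card U) \<le> f b"
    using insert.prems by (auto intro: mono_onD[where A = "{..<n}"])
  moreover have "b \<notin> U" using insert.hyps by blast
  ultimately show ?case using insert by (simp add: add_mono add.commute)
qed simp

definition landau_inequalities :: "int list \<Rightarrow> bool" where
  "landau_inequalities s \<longleftrightarrow> (\<forall>k\<le>length s. 0 \<le> landau_excess (int k) (sum_list (take k s)))"

lemma landau_inequalities_score_sequence: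
  assumes T: "tournament V T"
  defines "s \<equiv> map int (score_sequence V T)"
  shows "landau_inequalities s" "landau_excess (int (length s)) (sum_list s) = 0"
proof -
  obtain us where us: "distinct us" "set us = V"
    using finite_distinct_list[OF tournament_finite[OF T]] by blast
  define vs where "vs = sort_key (out_deg T) us"
  have vs: "distinct vs" "set vs = V" "sorted (map (out_deg T) vs)"
    using us by (simp_all add: vs_def)
  have s_eq: "s = map (\<lambda>v. int (out_deg T v)) vs"
    using score_sequence_eqI[OF vs(1,3)] vs(2) by (simp add: s_def)
  have sum_take: "sum_list (take k s) = (\<Sum>v\<in>set (take k vs). int (out_deg T v))" for k
    using vs(1) by (simp add: s_eq take_map sum_list_distinct_conv_sum_set)
  have card_take: "card (set (take k vs)) = min k (length s)" for k
    using vs(1) by (simp add: s_eq distinct_card min.commute)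
  show "landau_inequalities s"
    unfolding landau_inequalities_def
  proof (intro allI impI)
    fix k assume "k \<le> length s"
    then show "0 \<le> landau_excess (int k) (sum_list (take k s))"
      using tournament_landau_excess_nonneg[OF T, of "set (take k vs)"] vs(2)
        set_take_subset[of k vs]
      by (simp add: sum_take card_take)
  qed
  show "landau_excess (int (length s)) (sum_list s) = 0"
    using tournament_landau_excess_total[OF T] vs(2) sum_take[of "length s"]
      card_take[of "length s"]
    by (simp add: s_eq)
qed

lemma landau_score_sequence_exists:
  assumes "sorted s" and landau: "landau_inequalities s"
    and total: "landau_excess (int (length s)) (sum_list s) = 0"
  shows "\<exists>(V :: nat set) T. tournament V T \<and> map int (score_sequence V T) = s"
proof -
  have "\<exists>T. tournament {..<length s} T \<and> (\<forall>v\<in>{..<length s}. int (out_deg T v) = s ! v)"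
  proof (rule landau_tournament_exists)
    show "landau_excess (int (card {..<length s})) (\<Sum>v<length s. s ! v) = 0"
      using total by (simp add: sum_list_sum_nth atLeast0LessThan)
    fix U assume U_subset: "U \<subseteq> {..<length s}"
    then have card_le: "card U \<le> length s" using card_mono[OF finite_lessThan U_subset] by simp
    then have "sum_list (take (card U) s) = (\<Sum>v<card U. s ! v)"
      by (simp add: sum_list_sum_nth atLeast0LessThan)
    also have "\<dots> \<le> (\<Sum>v\<in>U. s ! v)"
      using U_subset \<open>sorted s\<close> finite_subset[OF U_subset]
      by (intro sum_lessThan_card_le[where n = "length s"]) (auto intro: mono_onI sorted_nth_mono)
    finally show "0 \<le> landau_excess (int (card U)) (\<Sum>v\<in>U. s ! v)"
      using landau card_le by (fastforce simp: landau_inequalities_def landau_excess_def)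
  qed simp
  then obtain T where T: "tournament {..<length s} T"
    and "\<And>v. v < length s \<Longrightarrow> int (out_deg T v) = s ! v" by auto
  then have map_out_deg: "map int (map (out_deg T) [0..<length s]) = s"
    by (intro nth_equalityI) simp_all
  have "sorted (map (out_deg T) [0..<length s])"
    using \<open>sorted s\<close>
    by (subst (asm) map_out_deg[symmetric]) (simp add: sorted_iff_nth_mono)
  then have "score_sequence {..<length s} T = map (out_deg T) [0..<length s]"
    using score_sequence_eqI[of "[0..<length s]" T] by (simp add: atLeast0LessThan)
  then show ?thesis using T map_out_deg by metis
qed

section \<open>Scores given in blocks\<close>

text \<open>
  The excess is a concave function of the number of vertices taken from one block, hence
  nonnegative on the block as soon as it is at both ends.
\<close>

lemma landau_excess_nonneg_between:
  fixes P Q a t r :: int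
  assumes "0 \<le> landau_excess P Q" "0 \<le> landau_excess (P + r) (Q + r * a)" "0 \<le> t" "t \<le> r"
  shows "0 \<le> landau_excess (P + t) (Q + t * a)"
proof (cases "r = 0")
  case False
  then have r_pos: "0 < r" using assms by simp
  have "0 \<le> (r - t) * landau_excess P Q + t * landau_excess (P + r) (Q + r * a)
      + t * (r * (r - t))"
    using assms by (intro add_nonneg_nonneg mult_nonneg_nonneg) auto
  also have "\<dots> = r * landau_excess (P + t) (Q + t * a)"
    by (simp add: landau_excess_def algebra_simps)
  finally show ?thesis using r_pos by (simp add: zero_le_mult_iff)
qed (use assms in simp)

lemma landau_inequalities_append_replicate:
  "landau_inequalities (s @ replicate r a) \<longleftrightarrow> landau_inequalities s \<and>
     0 \<le> landau_excess (int (length s) + int r) (sum_list s + int r * a)"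
  (is "?L \<longleftrightarrow> ?R")
proof
  assume L: ?L
  have "0 \<le> landau_excess (int k) (sum_list (take k s))" if "k \<le> length s" for k
    using L[unfolded landau_inequalities_def, rule_format, of k] that by simp
  moreover have "0 \<le> landau_excess (int (length s) + int r) (sum_list s + int r * a)"
    using L[unfolded landau_inequalities_def, rule_format, of "length s + r"]
    by (simp add: sum_list_replicate)
  ultimately show ?R by (simp add: landau_inequalities_def)
next
  assume R: ?R
  show ?L
    unfolding landau_inequalities_def
  proof (intro allI impI)
    fix k assume k: "k \<le> length (s @ replicate r a)"
    show "0 \<le> landau_excess (int k) (sum_list (take k (s @ replicate r a)))"
    proof (cases "k \<le> length s")
      case True
      then show ?thesis using R by (simp add: landau_inequalities_def)
    next
      case False
      have "0 \<le> landau_excess (int (length s)) (sum_list s)"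
        using R unfolding landau_inequalities_def by (metis order_refl take_all)
      then have "0 \<le> landau_excess (int (length s) + int (k - length s))
          (sum_list s + int (k - length s) * a)"
        by (rule landau_excess_nonneg_between) (use R k in auto)
      moreover have "min (k - length s) r = k - length s" using k by simp
      ultimately show ?thesis using False by (simp add: sum_list_replicate)
    qed
  qed
qed

definition agree_upto :: "nat \<Rightarrow> (nat \<Rightarrow> 'a) \<Rightarrow> (nat \<Rightarrow> 'a) \<Rightarrow> bool" where
  "agree_upto l x y \<longleftrightarrow> (\<forall>i\<in>{1..l}. x i = y i)"

definition block_scores :: "nat \<Rightarrow> (nat \<Rightarrow> int) \<Rightarrow> (nat \<Rightarrow> int) \<Rightarrow> int list" where
  "block_scores n \<alpha> x = concat (map (\<lambda>i. replicate (nat (x i)) (\<alpha> i)) [1..<Suc n])"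

lemma block_scores_0 [simp]: "block_scores 0 \<alpha> x = []"
  by (simp add: block_scores_def)

lemma block_scores_Suc [simp]:
  "block_scores (Suc n) \<alpha> x = block_scores n \<alpha> x @ replicate (nat (x (Suc n))) (\<alpha> (Suc n))"
  by (simp add: block_scores_def)

lemma block_scores_cong:
  assumes "agree_upto n x y"
  shows "block_scores n \<alpha> x = block_scores n \<alpha> y"
  unfolding block_scores_def using assms
  by (intro arg_cong[of _ _ concat] map_cong) (auto simp: agree_upto_def)

lemma sorted_block_scores:
  assumes "mono_on {1..n} \<alpha>"
  shows "sorted (block_scores n \<alpha> x)"
  using assms
proof (induction n)
  case (Suc n)
  have "s \<le> \<alpha> (Suc n)" if s_in: "s \<in> set (block_scores n \<alpha> x)" for s
  proof -
    obtain i where "i \<in> {1..n}" "s = \<alpha> i" using s_in by (fastforce simp: block_scores_def)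
    then show ?thesis using mono_onD[OF Suc.prems, of i "Suc n"] by simp
  qed
  moreover have "mono_on {1..n} \<alpha>" using Suc.prems by (rule mono_on_subset) auto
  ultimately show ?case using Suc.IH by (auto simp: sorted_append)
qed simp

definition landau_prefix :: "(nat \<Rightarrow> int) \<Rightarrow> nat \<Rightarrow> int \<Rightarrow> int \<Rightarrow> (nat \<Rightarrow> int) \<Rightarrow> bool" where
  "landau_prefix \<alpha> l P Q x \<longleftrightarrow>
     (\<forall>i\<in>{1..l}. 1 \<le> x i) \<and> landau_inequalities (block_scores l \<alpha> x) \<and>
     P = int (length (block_scores l \<alpha> x)) \<and> Q = sum_list (block_scores l \<alpha> x)"

definition landau_exact :: "(nat \<Rightarrow> int) \<Rightarrow> nat \<Rightarrow> (nat \<Rightarrow> int) \<Rightarrow> bool" where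
  "landau_exact \<alpha> n x \<longleftrightarrow> (\<exists>P Q. landau_prefix \<alpha> n P Q x \<and> landau_excess P Q = 0)"

theorem correct_score_sequence_iff_landau_exact:
  assumes "mono_on {1..n} \<alpha>"
  shows "correct_score_sequence n \<alpha> x \<longleftrightarrow> landau_exact \<alpha> n x"
proof -
  define s where "s = block_scores n \<alpha> x"
  have "(\<exists>(V :: nat set) T. tournament V T \<and> map int (score_sequence V T) = s) \<longleftrightarrow>
      landau_inequalities s \<and> landau_excess (int (length s)) (sum_list s) = 0"
    using landau_inequalities_score_sequence
      landau_score_sequence_exists[OF sorted_block_scores[OF assms], of x, folded s_def]
    by (intro iffI) (blast, blast)
  then show ?thesis
    unfolding correct_score_sequence_def block_scores_def[symmetric] landau_exact_def
      landau_prefix_def s_def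
    by blast
qed

lemma landau_prefix_0 [simp]: "landau_prefix \<alpha> 0 P Q x \<longleftrightarrow> P = 0 \<and> Q = 0"
  by (auto simp: landau_prefix_def landau_inequalities_def landau_excess_def)

lemma landau_prefix_Suc:
  "landau_prefix \<alpha> (Suc l) P Q x \<longleftrightarrow>
     landau_prefix \<alpha> l (P - x (Suc l)) (Q - x (Suc l) * \<alpha> (Suc l)) x \<and>
     1 \<le> x (Suc l) \<and> 0 \<le> landau_excess P Q"
  by (auto simp: landau_prefix_def landau_inequalities_append_replicate sum_list_replicate
      atLeastAtMostSuc_conv diff_eq_eq)

lemma landau_prefix_cong:
  assumes "agree_upto l x y"
  shows "landau_prefix \<alpha> l P Q x \<longleftrightarrow> landau_prefix \<alpha> l P Q y"
  unfolding landau_prefix_def using assms block_scores_cong[OF assms] by (simp add: agree_upto_def)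

lemma landau_prefix_excess_nonneg: "landau_prefix \<alpha> l P Q x \<Longrightarrow> 0 \<le> landau_excess P Q"
  by (cases l) (simp_all add: landau_prefix_Suc landau_excess_def)

lemma landau_prefix_pos: "landau_prefix \<alpha> n P Q x \<Longrightarrow> i \<in> {1..n} \<Longrightarrow> 1 \<le> x i"
  by (simp add: landau_prefix_def)

lemma landau_prefix_sums:
  assumes "landau_prefix \<alpha> l P Q x"
  shows "P = (\<Sum>i = 1..l. x i)" "Q = (\<Sum>i = 1..l. x i * \<alpha> i)"
  using assms by (induction l arbitrary: P Q) (fastforce simp: landau_prefix_Suc)+

lemma landau_prefix_sum_gaps:
  assumes "landau_prefix \<alpha> l P Q x"
  shows "(\<Sum>i = 1..l. (a - \<alpha> i) * x i) = P * a - Q"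
  unfolding landau_prefix_sums[OF assms]
  by (simp add: sum_distrib_left algebra_simps sum_subtractf)

lemma landau_prefix_extend:
  assumes "landau_prefix \<alpha> n N R x" "l < n" "landau_prefix \<alpha> l P Q x"
  shows "landau_prefix \<alpha> (Suc l) (P + x (Suc l)) (Q + x (Suc l) * \<alpha> (Suc l)) x"
  using Suc_leI[OF assms(2)] assms(1)
proof (induction n arbitrary: N R rule: dec_induct)
  case base
  then show ?case
    using landau_prefix_sums[OF base] landau_prefix_sums[OF assms(3)] by simp
next
  case (step n)
  then show ?case using landau_prefix_Suc[of \<alpha> n] by blast
qed

section \<open>The search bound\<close>

text \<open>
  The excess after a further block of size \<open>t\<close> is quadratic in \<open>t\<close> with the roots \<open>cb P Q a\<close> and,
  if it is nonnegative for \<open>t = 0\<close>, a second root that is not positive.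
\<close>

lemma cb_landau_excess:
  fixes P Q a t :: real
  assumes excess: "0 \<le> landau_excess P Q" and t_pos: "0 < t"
  shows "t \<le> cb P Q a \<longleftrightarrow> 0 \<le> landau_excess (P + t) (Q + t * a)"
    and "t = cb P Q a \<longleftrightarrow> landau_excess (P + t) (Q + t * a) = 0"
proof -
  define B where "B = 2 * (a - P) + 1"
  define D where "D = sqrt (B\<^sup>2 + 4 * landau_excess P Q)"
  have "8 * (Q - P * (P - 1) / 2) = 4 * landau_excess P Q"
    by (simp add: landau_excess_def field_simps)
  then have cb_eq: "cb P Q a = (B + D) / 2" by (simp only: cb_def B_def D_def)
  have D_square: "D\<^sup>2 = B\<^sup>2 + 4 * landau_excess P Q" using excess by (simp add: D_def)
  have "\<bar>B\<bar> \<le> D" unfolding D_def using excess by (intro real_le_rsqrt) simp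
  then have other_root_less: "0 < t - (B - D) / 2" using t_pos by simp
  have "(cb P Q a - t) * (t - (B - D) / 2) = t * (B - t) + (D\<^sup>2 - B\<^sup>2) / 4"
    by (simp add: cb_eq power2_eq_square field_simps)
  also have "\<dots> = landau_excess (P + t) (Q + t * a)"
    unfolding D_square landau_excess_add B_def by simp
  finally have factor: "landau_excess (P + t) (Q + t * a) = (cb P Q a - t) * (t - (B - D) / 2)" ..
  show "t \<le> cb P Q a \<longleftrightarrow> 0 \<le> landau_excess (P + t) (Q + t * a)"
    and "t = cb P Q a \<longleftrightarrow> landau_excess (P + t) (Q + t * a) = 0"
    unfolding factor using other_root_less by (auto simp: zero_le_mult_iff)
qed

lemma int_cb_landau_excess:
  fixes P Q a t :: int
  assumes "0 \<le> landau_excess P Q" "1 \<le> t"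
  shows "real_of_int t \<le> cb P Q a \<longleftrightarrow> 0 \<le> landau_excess (P + t) (Q + t * a)"
    and "real_of_int t = cb P Q a \<longleftrightarrow> landau_excess (P + t) (Q + t * a) = 0"
proof -
  have "0 \<le> landau_excess (real_of_int P) (real_of_int Q)"
    using assms(1) by (simp flip: of_int_landau_excess)
  note cb = cb_landau_excess[OF this, of "real_of_int t" "real_of_int a"]
  have excess: "landau_excess (real_of_int P + real_of_int t) (real_of_int Q + real_of_int t * a) =
      real_of_int (landau_excess (P + t) (Q + t * a))"
    by (simp add: of_int_landau_excess)
  show "real_of_int t \<le> cb P Q a \<longleftrightarrow> 0 \<le> landau_excess (P + t) (Q + t * a)"
    and "real_of_int t = cb P Q a \<longleftrightarrow> landau_excess (P + t) (Q + t * a) = 0"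
    using cb assms(2) by (simp_all add: excess)
qed

lemma landau_prefix_upd: "landau_prefix \<alpha> l P Q (x(Suc l := t)) \<longleftrightarrow> landau_prefix \<alpha> l P Q x"
  by (rule landau_prefix_cong) (simp add: agree_upto_def)

lemma landau_prefix_upd_Suc:
  assumes "landau_prefix \<alpha> l P Q x"
  shows "landau_prefix \<alpha> (Suc l) (P + t) (Q + t * \<alpha> (Suc l)) (x(Suc l := t)) \<longleftrightarrow>
    1 \<le> t \<and> real_of_int t \<le> cb P Q (\<alpha> (Suc l))"
  using assms int_cb_landau_excess(1)[OF landau_prefix_excess_nonneg[OF assms], of t "\<alpha> (Suc l)"]
  by (auto simp: landau_prefix_Suc landau_prefix_upd)

lemma landau_exact_upd_Suc:
  assumes "landau_prefix \<alpha> l P Q x"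
  shows "landau_exact \<alpha> (Suc l) (x(Suc l := t)) \<longleftrightarrow>
    1 \<le> t \<and> real_of_int t = cb P Q (\<alpha> (Suc l))"
proof -
  have "landau_prefix \<alpha> l (N - t) (R - t * \<alpha> (Suc l)) x \<longleftrightarrow>
      N = P + t \<and> R = Q + t * \<alpha> (Suc l)" for N R
    using assms by (auto simp: landau_prefix_def)
  then have "landau_exact \<alpha> (Suc l) (x(Suc l := t)) \<longleftrightarrow>
      1 \<le> t \<and> landau_excess (P + t) (Q + t * \<alpha> (Suc l)) = 0"
    by (auto simp: landau_exact_def landau_prefix_Suc landau_prefix_upd)
  then show ?thesis
    using int_cb_landau_excess(2)[OF landau_prefix_excess_nonneg[OF assms]] by blast
qed

section \<open>The procedure \<open>end\<close>\<close>

definition fr_t1 :: "nat \<Rightarrow> (nat \<Rightarrow> int) \<Rightarrow> int \<Rightarrow> int \<Rightarrow> int \<Rightarrow> real" where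
  "fr_t1 n \<alpha> P Q i = real_of_int ((2 * \<alpha> n + 1 - 2 * i) * i - P * \<alpha> n + Q) / real_of_int (fr_m n \<alpha>)"

definition fr_t2 :: "nat \<Rightarrow> (nat \<Rightarrow> int) \<Rightarrow> int \<Rightarrow> int \<Rightarrow> int \<Rightarrow> real" where
  "fr_t2 n \<alpha> P Q i = cb (P + fr_t1 n \<alpha> P Q i) (Q + fr_t1 n \<alpha> P Q i * \<alpha> (n - 1)) (\<alpha> n)"

lemma of_int_le_half_iff: "real_of_int i \<le> (2 * real_of_int a + 1) / 2 \<longleftrightarrow> i \<le> a"
proof -
  have "real_of_int i \<le> (2 * real_of_int a + 1) / 2 \<longleftrightarrow> real_of_int (2 * i) \<le> real_of_int (2 * a + 1)"
    by auto
  then show ?thesis by (simp only: of_int_le_iff) presburger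
qed

lemma fr_end_step:
  assumes "0 < fr_m n \<alpha>" "i \<le> \<alpha> n"
  shows "fr_end n \<alpha> i P Q x =
    (if fr_t1 n \<alpha> P Q i \<in> \<int> \<and> 1 \<le> fr_t1 n \<alpha> P Q i \<and> fr_t1 n \<alpha> P Q i \<le> cb P Q (\<alpha> (n - 1)) \<and>
       fr_t2 n \<alpha> P Q i \<in> \<int> \<and> 1 \<le> fr_t2 n \<alpha> P Q i
     then (True, x(n := \<lfloor>fr_t2 n \<alpha> P Q i\<rfloor>, n - 1 := \<lfloor>fr_t1 n \<alpha> P Q i\<rfloor>))
     else fr_end n \<alpha> (i + fr_m n \<alpha>) P Q x)"
  using assms
  by (subst fr_end.simps)
    (simp only: fr_t1_def fr_t2_def of_int_le_half_iff Let_def simp_thms if_True)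

lemma fr_end_stop: "\<alpha> n < i \<Longrightarrow> fr_end n \<alpha> i P Q x = (False, x)"
  by (simp add: fr_end.simps[of n \<alpha> i] of_int_le_half_iff)

definition fr_end_hit :: "nat \<Rightarrow> (nat \<Rightarrow> int) \<Rightarrow> int \<Rightarrow> int \<Rightarrow> int \<Rightarrow> int \<Rightarrow> int \<Rightarrow> bool" where
  "fr_end_hit n \<alpha> P Q i t u \<longleftrightarrow>
     t * fr_m n \<alpha> = (2 * \<alpha> n + 1 - 2 * i) * i - P * \<alpha> n + Q \<and>
     1 \<le> t \<and> real_of_int t \<le> cb P Q (\<alpha> (n - 1)) \<and>
     1 \<le> u \<and> real_of_int u = cb (P + t) (Q + t * \<alpha> (n - 1)) (\<alpha> n)"

lemma fr_end_hit_iff_real: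
  assumes m_pos: "0 < fr_m n \<alpha>"
  shows "fr_end_hit n \<alpha> P Q i t u \<longleftrightarrow>
    fr_t1 n \<alpha> P Q i = real_of_int t \<and> fr_t2 n \<alpha> P Q i = real_of_int u \<and>
    1 \<le> t \<and> real_of_int t \<le> cb P Q (\<alpha> (n - 1)) \<and> 1 \<le> u"
proof -
  have "fr_t1 n \<alpha> P Q i = t \<longleftrightarrow>
      real_of_int ((2 * \<alpha> n + 1 - 2 * i) * i - P * \<alpha> n + Q) = real_of_int (t * fr_m n \<alpha>)"
    unfolding fr_t1_def of_int_mult[of t] using m_pos by (subst divide_eq_eq) auto
  then have t1_eq_iff: "fr_t1 n \<alpha> P Q i = t \<longleftrightarrow>
      t * fr_m n \<alpha> = (2 * \<alpha> n + 1 - 2 * i) * i - P * \<alpha> n + Q"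
    by (simp only: of_int_eq_iff) auto
  have t2_eq: "fr_t2 n \<alpha> P Q i = cb (P + t) (Q + t * \<alpha> (n - 1)) (\<alpha> n)" if "fr_t1 n \<alpha> P Q i = t"
    by (simp add: fr_t2_def that)
  show ?thesis unfolding fr_end_hit_def t1_eq_iff[symmetric] using t2_eq by auto
qed

lemma fr_end_found:
  assumes "0 < fr_m n \<alpha>" "i \<le> \<alpha> n" "fr_end_hit n \<alpha> P Q i t u"
  shows "fr_end n \<alpha> i P Q x = (True, x(n := u, n - 1 := t))"
  using assms by (simp add: fr_end_step fr_end_hit_iff_real)

lemma fr_end_next:
  assumes "0 < fr_m n \<alpha>" "i \<le> \<alpha> n" "\<nexists>t u. fr_end_hit n \<alpha> P Q i t u"
  shows "fr_end n \<alpha> i P Q x = fr_end n \<alpha> (i + fr_m n \<alpha>) P Q x"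
  using assms(3) unfolding fr_end_step[OF assms(1,2)] fr_end_hit_iff_real[OF assms(1)]
  by (auto elim!: Ints_cases)

lemma fr_end_result:
  assumes "0 < fr_m n \<alpha>"
  shows "fr_end n \<alpha> i P Q x = (False, x) \<or>
    (\<exists>j t u. fr_end_hit n \<alpha> P Q j t u \<and> fr_end n \<alpha> i P Q x = (True, x(n := u, n - 1 := t)))"
proof (induction "nat (\<alpha> n + 1 - i)" arbitrary: i rule: less_induct)
  case less
  consider (stop) "\<alpha> n < i"
    | (found) t u where "i \<le> \<alpha> n" "fr_end_hit n \<alpha> P Q i t u"
    | (continue) "i \<le> \<alpha> n" "\<nexists>t u. fr_end_hit n \<alpha> P Q i t u"
    by (meson not_le)
  then show ?case
  proof cases
    case stop
    then show ?thesis using fr_end_stop by blast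
  next
    case found
    then show ?thesis using fr_end_found[OF assms] by blast
  next
    case continue
    then show ?thesis
      unfolding fr_end_next[OF assms continue] using assms by (intro less.hyps) simp
  qed
qed

lemma fr_end_complete:
  assumes m_pos: "0 < fr_m n \<alpha>" and hit: "fr_end_hit n \<alpha> P Q j t u" and "j \<le> \<alpha> n"
    and "j = i + int k * fr_m n \<alpha>"
  shows "fst (fr_end n \<alpha> i P Q x)"
  using assms(4)
proof (induction k arbitrary: i)
  case 0
  then show ?case using fr_end_found[OF m_pos _ hit] assms(3) by simp
next
  case (Suc k)
  have "j = i + fr_m n \<alpha> + int k * fr_m n \<alpha>" using Suc.prems by (simp add: algebra_simps)
  then have IH: "fst (fr_end n \<alpha> (i + fr_m n \<alpha>) P Q x)" by (rule Suc.IH)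
  have "i \<le> \<alpha> n" using Suc.prems m_pos assms(3) by (smt (verit) mult_nonneg_nonneg of_nat_0_le_iff)
  then show ?case using IH fr_end_found[OF m_pos] fr_end_next[OF m_pos] by (metis fst_conv)
qed

lemma fr_end_hit_iff:
  assumes "2 \<le> n" and prefix: "landau_prefix \<alpha> (n - 2) P Q x"
  shows "fr_end_hit n \<alpha> P Q i t u \<longleftrightarrow>
    t * fr_m n \<alpha> = (2 * \<alpha> n + 1 - 2 * i) * i - P * \<alpha> n + Q \<and>
    landau_exact \<alpha> n (x(n - 1 := t, n := u))"
proof -
  obtain q where n_eq: "n = Suc (Suc q)" using assms(1) by (metis add_2_eq_Suc le_Suc_ex)
  have prefix_x: "landau_prefix \<alpha> q P Q x" using prefix by (simp add: n_eq)
  note upd = landau_prefix_upd_Suc[OF prefix_x, of t]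
  have "landau_prefix \<alpha> (Suc q) (P + t) (Q + t * \<alpha> (Suc q)) (x(Suc q := t))"
    if exact: "landau_exact \<alpha> n (x(Suc q := t, Suc (Suc q) := u))"
  proof -
    define y where "y = x(Suc q := t, Suc (Suc q) := u)"
    obtain N R where full: "landau_prefix \<alpha> (Suc (Suc q)) N R y"
      using exact by (auto simp: landau_exact_def n_eq y_def)
    have "agree_upto q x y" by (simp add: y_def agree_upto_def)
    then have "landau_prefix \<alpha> q P Q y" using prefix_x landau_prefix_cong by blast
    then have "landau_prefix \<alpha> (Suc q) (P + y (Suc q)) (Q + y (Suc q) * \<alpha> (Suc q)) y"
      by (rule landau_prefix_extend[OF full less_SucI[OF lessI]])
    then show ?thesis by (simp add: y_def landau_prefix_upd)
  qed
  then have "landau_exact \<alpha> n (x(Suc q := t, Suc (Suc q) := u)) \<longleftrightarrow>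
      (1 \<le> t \<and> real_of_int t \<le> cb P Q (\<alpha> (Suc q))) \<and>
      1 \<le> u \<and> real_of_int u = cb (P + t) (Q + t * \<alpha> (Suc q)) (\<alpha> n)"
    unfolding n_eq using landau_exact_upd_Suc upd by blast
  then show ?thesis by (simp add: fr_end_hit_def n_eq)
qed

lemma fr_end_agree_upto:
  assumes "0 < fr_m n \<alpha>" "2 \<le> n"
  shows "agree_upto (n - 2) (snd (fr_end n \<alpha> i P Q x)) x"
  using fr_end_result[OF assms(1), of i P Q x] assms(2) by (auto simp: agree_upto_def)

lemma fr_end_sound:
  assumes "0 < fr_m n \<alpha>" "2 \<le> n" "landau_prefix \<alpha> (n - 2) P Q x"
    and "fst (fr_end n \<alpha> i P Q x)"
  shows "landau_exact \<alpha> n (snd (fr_end n \<alpha> i P Q x))"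
proof -
  obtain j t u where hit: "fr_end_hit n \<alpha> P Q j t u"
    and res: "fr_end n \<alpha> i P Q x = (True, x(n := u, n - 1 := t))"
    using fr_end_result[OF assms(1), of i P Q x] assms(4) by auto
  have "landau_exact \<alpha> n (x(n - 1 := t, n := u))"
    using hit fr_end_hit_iff[OF assms(2,3)] by blast
  moreover have "x(n := u, n - 1 := t) = x(n - 1 := t, n := u)"
    using assms(2) by (intro fun_upd_twist) simp
  ultimately show ?thesis by (simp only: res snd_conv)
qed

section \<open>Soundness of the search\<close>

lemma for_loop_invariant:
  assumes "I x" "\<And>i y. i \<in> set is \<Longrightarrow> I y \<Longrightarrow> I (snd (body i y))"
  shows "I (snd (for_loop is body x))"
  using assms by (induction "is" arbitrary: x) (auto simp: case_prod_beta)

lemma for_loop_sound: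
  assumes "fst (for_loop is body x)" "I x"
    and "\<And>i y. i \<in> set is \<Longrightarrow> I y \<Longrightarrow> I (snd (body i y))"
    and "\<And>i y. i \<in> set is \<Longrightarrow> I y \<Longrightarrow> fst (body i y) \<Longrightarrow> R (snd (body i y))"
  shows "R (snd (for_loop is body x))"
  using assms by (induction "is" arbitrary: x) (auto simp: case_prod_beta split: if_splits)

lemma for_loop_complete:
  assumes "a \<in> set is" "I x"
    and "\<And>i y. i \<in> set is \<Longrightarrow> I y \<Longrightarrow> I (snd (body i y))"
    and "\<And>y. I y \<Longrightarrow> fst (body a y)"
  shows "fst (for_loop is body x)"
  using assms by (induction "is" arbitrary: x) (auto simp: case_prod_beta)

definition fr_residues :: "nat \<Rightarrow> (nat \<Rightarrow> int) \<Rightarrow> nat \<Rightarrow> (nat \<Rightarrow> int) \<Rightarrow> int list" where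
  "fr_residues n \<alpha> l x =
     map (\<lambda>s. (s - (\<Sum>i = 1..l. fr_g n \<alpha> i * x i)) mod fr_m n \<alpha>) (fr_sol n \<alpha>)"

lemma fr_residues_cong:
  assumes "agree_upto l x y"
  shows "fr_residues n \<alpha> l x = fr_residues n \<alpha> l y"
proof -
  have "(\<Sum>i = 1..l. fr_g n \<alpha> i * x i) = (\<Sum>i = 1..l. fr_g n \<alpha> i * y i)"
    using assms by (intro sum.cong) (auto simp: agree_upto_def)
  then show ?thesis by (simp add: fr_residues_def)
qed

definition fr_try ::
  "nat \<Rightarrow> (nat \<Rightarrow> int) \<Rightarrow> nat \<Rightarrow> int \<Rightarrow> int \<Rightarrow> int \<Rightarrow> (nat \<Rightarrow> int) \<Rightarrow> bool \<times> (nat \<Rightarrow> int)" where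
  "fr_try n \<alpha> l P Q i x =
     (let y = x(Suc l := i); S = fr_residues n \<alpha> (Suc l) y
      in if potential S (fr_mu n \<alpha> (Suc (Suc l)))
         then fr_rec n \<alpha> S (Suc (Suc l)) (P + i) (Q + i * \<alpha> (Suc l)) y
         else (False, x))"

definition fr_finish ::
  "nat \<Rightarrow> (nat \<Rightarrow> int) \<Rightarrow> int list \<Rightarrow> int \<Rightarrow> int \<Rightarrow> int \<Rightarrow> (nat \<Rightarrow> int) \<Rightarrow> bool \<times> (nat \<Rightarrow> int)" where
  "fr_finish n \<alpha> S P Q i x = (if S ! nat i = 0 then fr_end n \<alpha> i P Q x else (False, x))"

lemma fr_rec_try:
  assumes "l < n - 2"
  shows "fr_rec n \<alpha> S (Suc l) P Q x = for_loop [1..\<lfloor>cb P Q (\<alpha> (Suc l))\<rfloor>] (fr_try n \<alpha> l P Q) x"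
proof -
  have "(\<Sum>j = 1..l. fr_g n \<alpha> j * y j) + fr_g n \<alpha> (Suc l) * i =
      (\<Sum>j = 1..Suc l. fr_g n \<alpha> j * (y(Suc l := i)) j)" for y i
    by simp
  moreover have "\<not> n - 1 \<le> Suc l" using assms by simp
  ultimately show ?thesis
    unfolding fr_rec.simps[of n \<alpha> S "Suc l"] fr_try_def[abs_def] fr_residues_def Let_def
    by (simp only: if_False diff_Suc_1 Suc_eq_plus1[symmetric])
qed

lemma fr_rec_finish:
  "fr_rec n \<alpha> S (Suc (n - 2)) P Q x = for_loop [0..fr_m n \<alpha> - 1] (fr_finish n \<alpha> S P Q) x"
  unfolding fr_rec.simps[of n \<alpha> S "Suc (n - 2)"] fr_finish_def[abs_def] by simp

lemma fr_finish_agree_upto: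
  assumes "0 < fr_m n \<alpha>" "2 \<le> n"
  shows "agree_upto (n - 2) (snd (fr_finish n \<alpha> S P Q i x)) x"
  using fr_end_agree_upto[OF assms] by (simp add: fr_finish_def agree_upto_def)

lemma fr_rec_agree_upto:
  assumes "0 < fr_m n \<alpha>" "2 \<le> n" "l \<le> n - 2"
  shows "agree_upto l (snd (fr_rec n \<alpha> S (Suc l) P Q x)) x"
  using assms(3)
proof (induction l arbitrary: S P Q x rule: inc_induct)
  case base
  show ?case
    unfolding fr_rec_finish
    by (rule for_loop_invariant[where I = "\<lambda>y. agree_upto (n - 2) y x"])
      (use fr_finish_agree_upto[OF assms(1,2)] in \<open>auto simp: agree_upto_def\<close>)
next
  case (step l)
  show ?case
    unfolding fr_rec_try[OF step.hyps(2)]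
    by (rule for_loop_invariant[where I = "\<lambda>y. agree_upto l y x"])
      (use step.IH in \<open>auto simp: agree_upto_def fr_try_def Let_def\<close>)
qed

lemma fr_try_agree_upto:
  assumes "0 < fr_m n \<alpha>" "2 \<le> n" "l < n - 2"
  shows "agree_upto l (snd (fr_try n \<alpha> l P Q i x)) x"
  using fr_rec_agree_upto[OF assms(1,2), of "Suc l"] assms(3)
  by (auto simp: agree_upto_def fr_try_def Let_def)

lemma fr_rec_sound:
  assumes m_pos: "0 < fr_m n \<alpha>" and n_ge_2: "2 \<le> n" and "l \<le> n - 2"
    and "landau_prefix \<alpha> l P Q x" "fst (fr_rec n \<alpha> S (Suc l) P Q x)"
  shows "landau_exact \<alpha> n (snd (fr_rec n \<alpha> S (Suc l) P Q x))"
  using assms(3-)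
proof (induction l arbitrary: S P Q x rule: inc_induct)
  case base
  show ?case
    unfolding fr_rec_finish
  proof (rule for_loop_sound[where I = "landau_prefix \<alpha> (n - 2) P Q"])
    show "fst (for_loop [0..fr_m n \<alpha> - 1] (fr_finish n \<alpha> S P Q) x)"
      using base.prems(2) by (simp only: fr_rec_finish)
    show "landau_prefix \<alpha> (n - 2) P Q x" by (rule base.prems(1))
    fix i y assume prefix_y: "landau_prefix \<alpha> (n - 2) P Q y"
    show "landau_prefix \<alpha> (n - 2) P Q (snd (fr_finish n \<alpha> S P Q i y))"
      using prefix_y landau_prefix_cong[OF fr_finish_agree_upto[OF m_pos n_ge_2]] by blast
    show "landau_exact \<alpha> n (snd (fr_finish n \<alpha> S P Q i y))" if "fst (fr_finish n \<alpha> S P Q i y)"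
      using that fr_end_sound[OF m_pos n_ge_2 prefix_y]
      by (auto simp: fr_finish_def split: if_splits)
  qed
next
  case (step l)
  let ?range = "[1..\<lfloor>cb P Q (\<alpha> (Suc l))\<rfloor>]"
  show ?case
    unfolding fr_rec_try[OF step.hyps(2)]
  proof (rule for_loop_sound[where I = "landau_prefix \<alpha> l P Q"])
    show "fst (for_loop ?range (fr_try n \<alpha> l P Q) x)"
      using step.prems(2) by (simp only: fr_rec_try[OF step.hyps(2)])
    show "landau_prefix \<alpha> l P Q x" by (rule step.prems(1))
    fix i y assume i_range: "i \<in> set ?range" and prefix_y: "landau_prefix \<alpha> l P Q y"
    show "landau_prefix \<alpha> l P Q (snd (fr_try n \<alpha> l P Q i y))"
      using prefix_y landau_prefix_cong[OF fr_try_agree_upto[OF m_pos n_ge_2 step.hyps(2)]] by blast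
    have "landau_prefix \<alpha> (Suc l) (P + i) (Q + i * \<alpha> (Suc l)) (y(Suc l := i))"
      using landau_prefix_upd_Suc[OF prefix_y] i_range by (simp add: le_floor_iff)
    then show "landau_exact \<alpha> n (snd (fr_try n \<alpha> l P Q i y))" if "fst (fr_try n \<alpha> l P Q i y)"
      using that step.IH by (auto simp: fr_try_def Let_def split: if_splits)
  qed
qed

section \<open>Completeness of the search\<close>

definition search_index :: "nat \<Rightarrow> (nat \<Rightarrow> int) \<Rightarrow> (nat \<Rightarrow> int) \<Rightarrow> int \<Rightarrow> bool" where
  "search_index n \<alpha> x j \<longleftrightarrow> 0 \<le> j \<and> j \<le> \<alpha> n \<and>
     (2 * \<alpha> n + 1 - 2 * j) * j = (\<Sum>i = 1..n - 1. (\<alpha> n - \<alpha> i) * x i)"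

text \<open>One of the factors is even; \<open>j\<close> is its half.\<close>

lemma half_even_factor:
  fixes N a :: int
  assumes "0 \<le> N" "N \<le> 2 * a + 1"
  shows "\<exists>j. 0 \<le> j \<and> j \<le> a \<and> N * (2 * a + 1 - N) = 2 * ((2 * a + 1 - 2 * j) * j)"
proof (cases "even N")
  case True
  then obtain j where "N = 2 * j" by blast
  then show ?thesis using assms by (intro exI[of _ j]) auto
next
  case False
  then have "even (2 * a + 1 - N)" by simp
  then obtain j where "2 * a + 1 - N = 2 * j" by blast
  then have "N = 2 * a + 1 - 2 * j" "j \<le> a" "0 \<le> j" using assms by simp_all
  then show ?thesis by (intro exI[of _ j]) simp
qed

lemma exists_search_index:
  assumes mono: "mono_on {1..n} \<alpha>" and n_ge_1: "1 \<le> n" and exact: "landau_exact \<alpha> n x"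
  shows "\<exists>j. search_index n \<alpha> x j"
proof -
  obtain N R where prefix: "landau_prefix \<alpha> n N R x" and "landau_excess N R = 0"
    using exact by (auto simp: landau_exact_def)
  have pos: "0 < x i" if "i \<in> {1..n}" for i using landau_prefix_pos[OF prefix that] by simp
  define W where "W = (\<Sum>i = 1..n - 1. (\<alpha> n - \<alpha> i) * x i)"
  have "W = (\<Sum>i = 1..n. (\<alpha> n - \<alpha> i) * x i)"
    using n_ge_1 by (cases n) (simp_all add: W_def)
  also have "\<dots> = N * \<alpha> n - R" by (rule landau_prefix_sum_gaps[OF prefix])
  finally have twice_W: "N * (2 * \<alpha> n + 1 - N) = 2 * W"
    using \<open>landau_excess N R = 0\<close> by (simp add: landau_excess_def algebra_simps)
  have "0 \<le> W"
    unfolding W_def using n_ge_1 pos mono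
    by (intro sum_nonneg mult_nonneg_nonneg) (auto intro: mono_onD less_imp_le)
  then have "0 \<le> N * (2 * \<alpha> n + 1 - N)" by (simp add: twice_W)
  moreover have "0 < N"
    unfolding landau_prefix_sums(1)[OF prefix] using n_ge_1 pos by (intro sum_pos) auto
  ultimately have "N \<le> 2 * \<alpha> n + 1" by (simp add: zero_le_mult_iff)
  then show ?thesis
    using half_even_factor[of N "\<alpha> n"] \<open>0 < N\<close> twice_W by (auto simp: search_index_def W_def)
qed

lemma sum_fr_g_mod:
  "(\<Sum>i\<in>A. (\<alpha> n - \<alpha> i) * x i) mod fr_m n \<alpha> = (\<Sum>i\<in>A. fr_g n \<alpha> i * x i) mod fr_m n \<alpha>"
proof -
  have "((\<alpha> n - \<alpha> i) * x i) mod fr_m n \<alpha> = (fr_g n \<alpha> i * x i) mod fr_m n \<alpha>" for i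
    by (simp add: fr_g_def mod_mult_left_eq)
  then show ?thesis by (subst (1 2) mod_sum_eq[symmetric]) simp
qed

lemma length_fr_residues: "length (fr_residues n \<alpha> l x) = nat (fr_m n \<alpha>)"
  by (simp add: fr_residues_def fr_sol_def)

lemma fr_residues_0: "fr_residues n \<alpha> 0 x = fr_sol n \<alpha>"
  by (simp add: fr_residues_def fr_sol_def)

lemma nth_fr_residues:
  assumes m_pos: "0 < fr_m n \<alpha>" and l_less: "l < n" and index: "search_index n \<alpha> x j"
  shows "fr_residues n \<alpha> l x ! nat (j mod fr_m n \<alpha>) =
    (\<Sum>i = Suc l..n - 1. fr_g n \<alpha> i * x i) mod fr_m n \<alpha>"
proof -
  define m where "m = fr_m n \<alpha>"
  define r where "r = j mod m"
  have r_bounds: "0 \<le> r" "r < m" using assms(1) by (simp_all add: m_def r_def)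
  have "fr_sol n \<alpha> ! nat r = ((2 * \<alpha> n + 1 - 2 * r) * r) mod m"
    using r_bounds by (simp add: fr_sol_def flip: m_def)
  also have "\<dots> = ((2 * \<alpha> n + 1 - 2 * j) * j) mod m"
    unfolding r_def by (intro mod_mult_cong mod_diff_cong refl) (simp_all add: mod_mult_right_eq)
  also have "\<dots> = (\<Sum>i = 1..n - 1. fr_g n \<alpha> i * x i) mod m"
    using index sum_fr_g_mod[of \<alpha> n x "{1..n - 1}"] by (simp add: search_index_def m_def)
  finally have "fr_residues n \<alpha> l x ! nat r =
      ((\<Sum>i = 1..n - 1. fr_g n \<alpha> i * x i) - (\<Sum>i = 1..l. fr_g n \<alpha> i * x i)) mod m"
    using r_bounds by (simp add: fr_residues_def fr_sol_def mod_diff_left_eq flip: m_def)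
  also have "(\<Sum>i = 1..n - 1. fr_g n \<alpha> i * x i) =
      (\<Sum>i = 1..l. fr_g n \<alpha> i * x i) + (\<Sum>i = Suc l..n - 1. fr_g n \<alpha> i * x i)"
    using sum.ub_add_nat[of 1 l "\<lambda>i. fr_g n \<alpha> i * x i" "n - 1 - l"] l_less by simp
  finally show ?thesis by (simp add: m_def r_def)
qed

lemma potential_fr_residues:
  assumes "0 < fr_m n \<alpha>" "l < n" "search_index n \<alpha> x j"
  shows "potential (fr_residues n \<alpha> l x) (fr_mu n \<alpha> (Suc l))"
proof -
  define s where "s = fr_residues n \<alpha> l x ! nat (j mod fr_m n \<alpha>)"
  have "fr_mu n \<alpha> (Suc l) dvd fr_g n \<alpha> i" if "i \<in> {Suc l..n - 1}" for i
    unfolding fr_mu_def using that by (intro Gcd_dvd) simp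
  then have "fr_mu n \<alpha> (Suc l) dvd (\<Sum>i = Suc l..n - 1. fr_g n \<alpha> i * x i)"
    by (intro dvd_sum dvd_mult2)
  moreover have "fr_mu n \<alpha> (Suc l) dvd fr_m n \<alpha>"
    unfolding fr_mu_def by (intro Gcd_dvd) simp
  ultimately have "s mod fr_mu n \<alpha> (Suc l) = 0"
    by (simp add: s_def nth_fr_residues[OF assms] dvd_mod flip: dvd_eq_mod_eq_0)
  moreover have "s \<in> set (fr_residues n \<alpha> l x)"
    unfolding s_def using assms(1) by (intro nth_mem) (simp add: length_fr_residues)
  ultimately show ?thesis unfolding potential_def by (intro bexI[of _ s] disjI2)
qed

lemma fr_finish_complete:
  assumes m_pos: "0 < fr_m n \<alpha>" and n_ge_2: "2 \<le> n" and exact: "landau_exact \<alpha> n z"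
    and prefix: "landau_prefix \<alpha> (n - 2) P Q z" and index: "search_index n \<alpha> z j"
  shows "fst (fr_finish n \<alpha> (fr_residues n \<alpha> (n - 2) z) P Q (j mod fr_m n \<alpha>) x)"
proof -
  have Suc_n_minus_2: "Suc (n - 2) = n - 1" using n_ge_2 by simp
  have "fr_g n \<alpha> (n - 1) = 0" by (simp add: fr_g_def fr_m_def)
  then have "fr_residues n \<alpha> (n - 2) z ! nat (j mod fr_m n \<alpha>) = 0"
    using nth_fr_residues[OF m_pos _ index, of "n - 2"] n_ge_2 by (simp add: Suc_n_minus_2)
  moreover have "fst (fr_end n \<alpha> (j mod fr_m n \<alpha>) P Q x)"
  proof (rule fr_end_complete[OF m_pos])
    have "(2 * \<alpha> n + 1 - 2 * j) * j = (\<Sum>i = 1..n - 2. (\<alpha> n - \<alpha> i) * z i) + z (n - 1) * fr_m n \<alpha>"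
      using index n_ge_2 sum.nat_ivl_Suc'[of 1 "n - 2" "\<lambda>i. (\<alpha> n - \<alpha> i) * z i"]
      by (simp add: search_index_def Suc_n_minus_2 fr_m_def)
    then have "z (n - 1) * fr_m n \<alpha> = (2 * \<alpha> n + 1 - 2 * j) * j - P * \<alpha> n + Q"
      unfolding landau_prefix_sum_gaps[OF prefix] by simp
    then show "fr_end_hit n \<alpha> P Q j (z (n - 1)) (z n)"
      using exact by (simp add: fr_end_hit_iff[OF n_ge_2 prefix])
    show "j \<le> \<alpha> n" using index by (simp add: search_index_def)
    have "0 \<le> j div fr_m n \<alpha>"
      using index m_pos by (simp add: search_index_def pos_imp_zdiv_nonneg_iff)
    then show "j = j mod fr_m n \<alpha> + int (nat (j div fr_m n \<alpha>)) * fr_m n \<alpha>"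
      by (simp only: int_nat_eq mod_div_mult_eq if_True)
  qed
  ultimately show ?thesis by (simp add: fr_finish_def)
qed

lemma fr_rec_complete:
  assumes m_pos: "0 < fr_m n \<alpha>" and n_ge_2: "2 \<le> n" and exact: "landau_exact \<alpha> n z"
    and index: "search_index n \<alpha> z j" and "l \<le> n - 2" "landau_prefix \<alpha> l P Q z" "agree_upto l x z"
  shows "fst (fr_rec n \<alpha> (fr_residues n \<alpha> l z) (Suc l) P Q x)"
  using assms(5-)
proof (induction l arbitrary: P Q x rule: inc_induct)
  case base
  show ?case
    unfolding fr_rec_finish
  proof (rule for_loop_complete[where I = "\<lambda>_. True" and a = "j mod fr_m n \<alpha>"])
    show "j mod fr_m n \<alpha> \<in> set [0..fr_m n \<alpha> - 1]" using m_pos by simp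
  qed (use fr_finish_complete[OF m_pos n_ge_2 exact base.prems(1) index] in simp_all)
next
  case (step l)
  have next_prefix: "landau_prefix \<alpha> (Suc l) (P + z (Suc l)) (Q + z (Suc l) * \<alpha> (Suc l)) z"
    using exact step.hyps step.prems(1) by (auto simp: landau_exact_def intro: landau_prefix_extend)
  show ?case
    unfolding fr_rec_try[OF step.hyps(2)]
  proof (rule for_loop_complete[where I = "\<lambda>y. agree_upto l y z" and a = "z (Suc l)"])
    show "z (Suc l) \<in> set [1..\<lfloor>cb P Q (\<alpha> (Suc l))\<rfloor>]"
      using next_prefix landau_prefix_upd_Suc[OF step.prems(1), of "z (Suc l)"]
      by (simp add: le_floor_iff)
    show "agree_upto l x z" by (rule step.prems(2))
    fix y assume agree_y: "agree_upto l y z"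
    then show "agree_upto l (snd (fr_try n \<alpha> l P Q i y)) z" for i
      using fr_try_agree_upto[OF m_pos n_ge_2 step.hyps(2), of P Q i y]
      by (simp add: agree_upto_def)
    define y' where "y' = y(Suc l := z (Suc l))"
    have agree_y': "agree_upto (Suc l) y' z"
      using agree_y by (simp add: y'_def agree_upto_def atLeastAtMostSuc_conv)
    have "potential (fr_residues n \<alpha> (Suc l) z) (fr_mu n \<alpha> (Suc (Suc l)))"
      using potential_fr_residues[OF m_pos _ index] step.hyps(2) by simp
    then show "fst (fr_try n \<alpha> l P Q (z (Suc l)) y)"
      using step.IH[OF next_prefix agree_y']
      by (simp add: fr_try_def fr_residues_cong[OF agree_y'] Let_def flip: y'_def)
  qed
qed

theorem theorem4p2:
  fixes n :: nat and \<alpha> x\<^sub>0 :: "nat \<Rightarrow> int"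
  assumes "n \<ge> 2"
    and "0 \<le> \<alpha> 1"
    and "strict_mono_on {1..n} \<alpha>"
    and "\<exists>x. correct_score_sequence n \<alpha> x"
  shows "\<exists>x. fast_reconstruction n \<alpha> x\<^sub>0 = (True, x) \<and> correct_score_sequence n \<alpha> x"
proof -
  have mono: "mono_on {1..n} \<alpha>" using assms(3) by (rule strict_mono_on_imp_mono_on)
  note correct_iff = correct_score_sequence_iff_landau_exact[OF mono]
  have m_pos: "0 < fr_m n \<alpha>"
    using strict_mono_onD[OF assms(3), of "n - 1" n] assms(1) by (simp add: fr_m_def)
  obtain z where exact: "landau_exact \<alpha> n z" using assms(4) correct_iff by blast
  obtain j where "search_index n \<alpha> z j" using exists_search_index[OF mono _ exact] assms(1) by auto
  then have found: "fst (fast_reconstruction n \<alpha> x\<^sub>0)"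
    using fr_rec_complete[OF m_pos assms(1) exact, of j 0 0 0 x\<^sub>0]
    by (simp add: fast_reconstruction_def fr_residues_0 agree_upto_def)
  then have "landau_exact \<alpha> n (snd (fast_reconstruction n \<alpha> x\<^sub>0))"
    using fr_rec_sound[OF m_pos assms(1), of 0 0 0 x\<^sub>0]
    by (simp add: fast_reconstruction_def)
  then show ?thesis using found correct_iff
    by (intro exI[of _ "snd (fast_reconstruction n \<alpha> x\<^sub>0)"]) (simp add: prod_eq_iff)
qed

end
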